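(* Let $n\in\mathbb{N}$, let $\{y_i\}_{i=1}^N\subset(-1,1)$ be a set of snapshot points and $\{w_i\}_{i=1}^N\subset\mathbb{R}^+$ positive weights such that $(g,f)_D:=\sum_{i=1}^N g(y_i)f(y_i)w_i$ is an inner product on $\mathcal{P}^n([-1,1])$ and $\sum_{i=1}^N w_i=2$. Let $$e=\max_{q\in\mathcal{P}^n([-1,1])\setminus\{0\}}\left|\frac{\int_{-1}^1 q(y)^2\,dy-\sum_{i=1}^N q(y_i)^2 w_i}{\int_{-1}^1 q(y)^2\,dy}\right|$$ and assume $e<1$. Let $\alpha\in\mathcal{P}^n([-1,1];\mathbb{R}^N)$ be such that $$\Phi\alpha(y)=\psi(y)\ \text{ for any } y\in(-1,1)\quad\text{and}\quad \int_{-1}^1\|W^{-1}\alpha(y)\|_2^2\,dy\le\frac{n+1}{1-e},$$ and define the operator $\Pi_n: C([-1,1];\mathbb{R}^m_{A_0})\to\mathcal{P}^n([-1,1];\mathbb{R}^m)$ by $(\Pi_n f)(y)=\sum_{i=1}^N\alpha_i(y)f(y_i)$. Then: (i) $\Pi_n f=f$ for any $f\in\mathcal{P}^n([-1,1];\mathbb{R}^m)$; (ii) for any $f\in C([-1,1];\mathbb{R}^m_{A_0})$, $$\|\Pi_n f\|_{L^2(-1,1;\mathbb{R}^m_{A_0})}\le C_{\rm s}(n)\,\|f\|_{L^\infty(-1,1;\mathbb{R}^m_{A_0})},\qquad C_{\rm s}(n)=\left(\frac{2n+2}{1-e}\right)^{1/2}.$$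
   Context: $\mathcal{P}^n([-1,1])$ is the space of real polynomials of degree at most $n$ on $[-1,1]$; $\mathcal{P}^n([-1,1];\mathbb{R}^k)$ is the space of $\mathbb{R}^k$-valued functions whose components are in $\mathcal{P}^n([-1,1])$. $A_0\in\mathbb{R}^{m\times m}$ is a symmetric positive definite matrix, $\|z\|_{A_0}=(z^TA_0z)^{1/2}$, and $\mathbb{R}^m_{A_0}$ is $\mathbb{R}^m$ equipped with the norm $\|\cdot\|_{A_0}$. Accordingly $\|f\|_{L^2(-1,1;\mathbb{R}^m_{A_0})}=\left(\int_{-1}^1\|f(y)\|_{A_0}^2\,dy\right)^{1/2}$ and $\|f\|_{L^\infty(-1,1;\mathbb{R}^m_{A_0})}=\operatorname{ess\,sup}_{y\in(-1,1)}\|f(y)\|_{A_0}$. $W=\mathrm{diag}(\sqrt{w_1},\ldots,\sqrt{w_N})$. $\{P_j\}_{j=0}^n$ is a $(\cdot,\cdot)_D$-orthogonal basis of $\mathcal{P}^n([-1,1])$ normalized so that $\int_{-1}^1P_j(y)^2\,dy=1$ for every $j$. $\Phi\in\mathbb{R}^{(n+1)\times N}$ is the matrix whose rows are indexed by $j=0,\ldots,n$ and columns by $i=1,\ldots,N$, with entries $P_j(y_i)$, and $\psi(y)=(P_0(y),\ldots,P_n(y))^T\in\mathbb{R}^{n+1}$. A function $\alpha$ with the two required properties exists whenever $e<1$. *)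

theory Defs
  imports
    "HOL-Analysis.Analysis"
    "HOL-Probability.Essential_Supremum"
    "HOL-Computational_Algebra.Polynomial"
begin

interpretation poly_vs: vector_space "smult :: real \<Rightarrow> real poly \<Rightarrow> real poly"
  by unfold_locales (simp_all add: smult_add_left smult_add_right)

text \<open>A real polynomial is determined by its values on [-1,1], so scalar polynomials on [-1,1]
  are elements of the type \<open>real poly\<close>. Vector-valued ones are functions on the real line of
  which only the restriction to [-1,1] matters.\<close>

definition poly_deg :: "nat \<Rightarrow> real poly set" where
  "poly_deg n = {p. degree p \<le> n}"

definition poly_maps :: "nat \<Rightarrow> (real \<Rightarrow> real ^ 'k) set" where
  "poly_maps n = {f. \<forall>i. \<exists>p \<in> poly_deg n. \<forall>y \<in> {-1..1}. f y $ i = poly p y}"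

definition inner_product_on :: "real poly set \<Rightarrow> (real poly \<Rightarrow> real poly \<Rightarrow> real) \<Rightarrow> bool" where
  "inner_product_on V B \<longleftrightarrow>
     (\<forall>f \<in> V. \<forall>g \<in> V. B f g = B g f) \<and>
     (\<forall>f \<in> V. \<forall>g \<in> V. \<forall>h \<in> V. B (f + g) h = B f h + B g h) \<and>
     (\<forall>c. \<forall>f \<in> V. \<forall>g \<in> V. B (smult c f) g = c * B f g) \<and>
     (\<forall>f \<in> V. f \<noteq> 0 \<longrightarrow> B f f > 0)"

definition is_basis_of :: "('d \<Rightarrow> real poly) \<Rightarrow> real poly set \<Rightarrow> bool" where
  "is_basis_of P V \<longleftrightarrow>
     inj P \<and> poly_vs.independent (range P) \<and> poly_vs.span (range P) = V"

definition discrete_ip :: "('N::finite \<Rightarrow> real) \<Rightarrow> ('N \<Rightarrow> real) \<Rightarrow> real poly \<Rightarrow> real poly \<Rightarrow> real" where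
  "discrete_ip pts w g f = (\<Sum>i\<in>UNIV. poly g (pts i) * poly f (pts i) * w i)"

text \<open>The greatest element exists: the quotient is a continuous function of \<open>q\<close>, invariant under
  scaling, on the nonzero vectors of a finite-dimensional space.\<close>

definition quad_error :: "nat \<Rightarrow> ('N::finite \<Rightarrow> real) \<Rightarrow> ('N \<Rightarrow> real) \<Rightarrow> real" where
  "quad_error n pts w = (GREATEST r. r \<in>
     (\<lambda>q. \<bar>((LBINT y:{-1..1}. (poly q y)\<^sup>2) - (\<Sum>i\<in>UNIV. (poly q (pts i))\<^sup>2 * w i))
           / (LBINT y:{-1..1}. (poly q y)\<^sup>2)\<bar>) ` (poly_deg n - {0}))"

definition sym_pos_def :: "real ^ 'm ^ 'm \<Rightarrow> bool" where
  "sym_pos_def A \<longleftrightarrow> transpose A = A \<and> (\<forall>z. z \<noteq> 0 \<longrightarrow> z \<bullet> (A *v z) > 0)"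

definition norm_A :: "real ^ 'm ^ 'm \<Rightarrow> real ^ 'm \<Rightarrow> real" where
  "norm_A A z = sqrt (z \<bullet> (A *v z))"

text \<open>Meaningful for functions whose squared norm is integrable on (-1,1), in particular for all
  members of \<open>poly_maps n\<close>.\<close>

definition L2_norm_A :: "real ^ 'm ^ 'm \<Rightarrow> (real \<Rightarrow> real ^ 'm) \<Rightarrow> real" where
  "L2_norm_A A f = sqrt (LBINT y:{-1<..<1}. (norm_A A (f y))\<^sup>2)"

definition Linf_norm_A :: "real ^ 'm ^ 'm \<Rightarrow> (real \<Rightarrow> real ^ 'm) \<Rightarrow> ereal" where
  "Linf_norm_A A f =
     esssup (restrict_space lborel {-1<..<1}) (\<lambda>y. ereal (norm_A A (f y)))"

definition weight_mat :: "('N::finite \<Rightarrow> real) \<Rightarrow> real ^ 'N ^ 'N" where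
  "weight_mat w = (\<chi> i j. if i = j then sqrt (w i) else 0)"

definition Phi_mat :: "('d \<Rightarrow> real poly) \<Rightarrow> ('N \<Rightarrow> real) \<Rightarrow> real ^ 'N ^ 'd" where
  "Phi_mat P pts = (\<chi> j i. poly (P j) (pts i))"

definition psi_vec :: "('d \<Rightarrow> real poly) \<Rightarrow> real \<Rightarrow> real ^ 'd" where
  "psi_vec P y = (\<chi> j. poly (P j) y)"

definition Pi_op ::
  "('N::finite \<Rightarrow> real) \<Rightarrow> (real \<Rightarrow> real ^ 'N) \<Rightarrow> (real \<Rightarrow> real ^ 'm) \<Rightarrow> real \<Rightarrow> real ^ 'm" where
  "Pi_op pts \<alpha> f y = (\<Sum>i\<in>UNIV. \<alpha> y $ i *\<^sub>R f (pts i))"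

lemma Pi_op_in_poly_maps:
  fixes \<alpha> :: "real \<Rightarrow> real ^ 'N::finite" and f :: "real \<Rightarrow> real ^ 'm"
  assumes "\<alpha> \<in> poly_maps n"
  shows "Pi_op pts \<alpha> f \<in> poly_maps n"
proof -
  have "\<forall>i. \<exists>p. p \<in> poly_deg n \<and> (\<forall>y \<in> {-1..1}. \<alpha> y $ i = poly p y)"
    using assms by (auto simp: poly_maps_def)
  then obtain p where p: "\<And>i. p i \<in> poly_deg n"
    "\<And>i y. y \<in> {-1..1} \<Longrightarrow> \<alpha> y $ i = poly (p i) y"
    by metis
  show ?thesis
    unfolding poly_maps_def
  proof (intro CollectI allI)
    fix k :: 'm
    let ?q = "\<Sum>i\<in>UNIV. smult (f (pts i) $ k) (p i)"
    have "degree ?q \<le> n"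
      using p(1) by (intro degree_sum_le) (auto simp: poly_deg_def intro: order_trans[OF degree_smult_le])
    moreover have "\<forall>y \<in> {-1..1}. Pi_op pts \<alpha> f y $ k = poly ?q y"
      using p(2) by (auto simp: Pi_op_def poly_sum mult.commute intro!: sum.cong)
    ultimately show "\<exists>q \<in> poly_deg n. \<forall>y \<in> {-1..1}. Pi_op pts \<alpha> f y $ k = poly q y"
      by (auto simp: poly_deg_def)
  qed
qed

end

(*
  Every p = P_j satisfies sum_i p(y_i) alpha_i = p on (-1,1), because Phi alpha = psi. By linearity
  this extends to all p of degree at most n, and by continuity to the endpoints;
  this is (i). For (ii), ||sum_i alpha_i(y) f(y_i)|| <= ||f|| sum_i |alpha_i(y)|, and
  Cauchy-Schwarz with the weights w_i gives
  (sum_i |alpha_i|)^2 <= (sum_i w_i) ||W^{-1} alpha||^2 = 2 ||W^{-1} alpha||^2.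
*)
theory Submission
  imports Defs
begin

text \<open>This is the triangle inequality for \<open>norm_A\<close> in squared form: after
  bilinear expansion every mixed term \<open>v i \<bullet> (A *v v j)\<close> is bounded by
  \<open>c\<close>, and the remaining double sum of absolute coefficients is a perfect
  square.\<close>

lemma quadratic_form_sum_le:
  fixes A :: "real ^ 'm::finite ^ 'm" and v :: "'i \<Rightarrow> real ^ 'm"
  assumes A: "sym_pos_def A" and le: "\<And>i. i \<in> I \<Longrightarrow> v i \<bullet> (A *v v i) \<le> c"
  shows "(\<Sum>i\<in>I. a i *\<^sub>R v i) \<bullet> (A *v (\<Sum>i\<in>I. a i *\<^sub>R v i)) \<le> c * (\<Sum>i\<in>I. \<bar>a i\<bar>)\<^sup>2"
proof -
  have nonneg: "0 \<le> z \<bullet> (A *v z)" for z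
    using A by (cases "z = 0") (auto simp: sym_pos_def_def less_imp_le)
  have sym: "x \<bullet> (A *v y) = y \<bullet> (A *v x)" for x y
    using A by (metis dot_lmul_matrix inner_commute sym_pos_def_def transpose_matrix_vector)
  \<comment> \<open>Nonnegativity of the form at the sum and the difference of \<open>v i\<close>
    and \<open>v j\<close>, together with symmetry, bounds twice the mixed term in absolute value by
    the sum of the two diagonal terms, hence by \<open>2 * c\<close>.\<close>
  have cross: "\<bar>v i \<bullet> (A *v v j)\<bar> \<le> c" if "i \<in> I" "j \<in> I" for i j
  proof -
    have "0 \<le> (v i + v j) \<bullet> (A *v (v i + v j))" "0 \<le> (v i - v j) \<bullet> (A *v (v i - v j))"
      by (rule nonneg)+
    then show ?thesis
      using le[OF that(1)] le[OF that(2)] sym[of "v j" "v i"]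
      by (simp add: matrix_vector_right_distrib matrix_vector_mult_diff_distrib inner_add inner_diff)
  qed
  have "(\<Sum>i\<in>I. a i *\<^sub>R v i) \<bullet> (A *v (\<Sum>i\<in>I. a i *\<^sub>R v i))
      = (\<Sum>i\<in>I. \<Sum>j\<in>I. a i * a j * (v i \<bullet> (A *v v j)))"
    by (simp add: linear_sum[OF matrix_vector_mul_linear] matrix_vector_mult_scaleR
        inner_sum_left inner_sum_right sum_distrib_left)
      (subst sum.swap, simp add: mult_ac)
  also have "\<dots> \<le> (\<Sum>i\<in>I. \<Sum>j\<in>I. \<bar>a i\<bar> * \<bar>a j\<bar> * c)"
  proof (intro sum_mono)
    fix i j assume ij: "i \<in> I" "j \<in> I"
    have "a i * a j * (v i \<bullet> (A *v v j)) \<le> \<bar>a i * a j\<bar> * \<bar>v i \<bullet> (A *v v j)\<bar>"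
      by (metis abs_ge_self abs_mult)
    also have "\<dots> \<le> \<bar>a i * a j\<bar> * c"
      by (intro mult_left_mono cross ij) simp
    finally show "a i * a j * (v i \<bullet> (A *v v j)) \<le> \<bar>a i\<bar> * \<bar>a j\<bar> * c"
      by (simp add: abs_mult)
  qed
  also have "\<dots> = c * (\<Sum>i\<in>I. \<bar>a i\<bar>)\<^sup>2"
    by (simp add: power2_eq_square sum_product sum_distrib_left mult_ac)
  finally show ?thesis .
qed

text \<open>The points of \<open>S\<close> where \<open>f\<close> exceeds its essential supremum
  form a null set, which is open by continuity. A nonempty open set is never null. This lets the
  essential supremum control values at individual snapshot points.\<close>

lemma le_esssup_if_continuous_on:
  fixes f :: "'a::euclidean_space \<Rightarrow> ereal"
  assumes "open S" "continuous_on S f" "x \<in> S"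
  shows "f x \<le> esssup (restrict_space lborel S) f"
proof (rule ccontr)
  let ?L = "esssup (restrict_space lborel S) f"
  let ?U = "S \<inter> f -` {?L<..}"
  assume "\<not> f x \<le> ?L"
  then have "x \<in> ?U"
    using assms(3) by auto
  have "open ?U"
    using assms(1,2) by (intro continuous_open_preimage) auto
  have "emeasure (restrict_space lborel S) ?U = 0"
    using esssup_zero_measure[of "restrict_space lborel S" f]
    by (simp add: space_restrict_space Int_def)
  then have "emeasure lborel ?U = 0"
    using \<open>open S\<close> by (subst (asm) emeasure_restrict_space) auto
  then have "?U \<in> null_sets lborel"
    using \<open>open ?U\<close> by (intro null_setsI) auto
  then have "negligible ?U"
    using null_sets_completionI negligible_iff_null_sets by blast
  then show False
    using open_not_negligible[OF \<open>open ?U\<close>] \<open>x \<in> ?U\<close> by blast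
qed

lemma continuous_on_norm_A:
  assumes "continuous_on S f"
  shows "continuous_on S (\<lambda>y. norm_A A (f y))"
  unfolding norm_A_def
  by (intro continuous_on_real_sqrt continuous_on_inner assms
      continuous_on_compose2[OF matrix_vector_mult_linear_continuous_on assms subset_UNIV])

lemma continuous_on_poly_maps:
  assumes "f \<in> poly_maps n"
  shows "continuous_on {-1..1} f"
proof -
  have "continuous_on {-1..1} (\<lambda>y. f y $ i)" for i
  proof -
    obtain p where p: "\<forall>y \<in> {-1..1}. f y $ i = poly p y"
      using assms by (auto simp: poly_maps_def)
    have "continuous_on {-1..1} (poly p)"
      by (intro continuous_intros)
    then show ?thesis
      by (rule continuous_on_eq) (simp add: p)
  qed
  then have "continuous_on {-1..1} (\<lambda>y. \<chi> i. f y $ i)"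
    by (rule continuous_on_vec_lambda)
  then show ?thesis by simp
qed

text \<open>The weights are positive, so the diagonal matrix is invertible. The formula turns the
  squared norm in the stability hypothesis into the sum of
  \<open>(\<alpha> y $ i)\<^sup>2 / w i\<close>.\<close>

lemma weight_mat_inv_mult:
  fixes w :: "'N::finite \<Rightarrow> real"
  assumes w: "\<forall>i. w i > 0"
  shows "matrix_inv (weight_mat w) *v x = (\<chi> i. x $ i / sqrt (w i))"
proof -
  have mult: "weight_mat w *v z = (\<chi> i. sqrt (w i) * z $ i)" for z
    by (simp add: weight_mat_def matrix_vector_mult_def if_distrib[of "\<lambda>c. c * _"] vec_eq_iff
        cong: if_cong)
  let ?D = "(\<chi> i j. if i = j then 1 / sqrt (w i) else 0) :: real ^ 'N ^ 'N"
  have "w i \<noteq> 0" "sqrt (w i) \<noteq> 0" for i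
    using w[rule_format, of i] by auto
  then have "weight_mat w ** ?D = mat 1"
    by (auto simp: weight_mat_def matrix_matrix_mult_def mat_def vec_eq_iff
        if_distrib[of "\<lambda>c. c * _"] cong: if_cong)
  then have "invertible (weight_mat w)"
    using invertible_right_inverse by blast
  \<comment> \<open>\<open>matrix_inv\<close> is a choice operator, so its defining property is
    available only once invertibility is known.\<close>
  then have "matrix_inv (weight_mat w) ** weight_mat w = mat 1"
    unfolding invertible_def matrix_inv_def by (rule someI2_ex) simp
  moreover have "x = weight_mat w *v (\<chi> i. x $ i / sqrt (w i))"
    using \<open>\<And>i. sqrt (w i) \<noteq> 0\<close> by (simp add: mult vec_eq_iff)
  ultimately show ?thesis
    by (metis matrix_vector_mul_assoc matrix_vector_mul_lid)
qed

lemma Pi_op_reproduces: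
  fixes f :: "real \<Rightarrow> real ^ 'm::finite" and \<alpha> :: "real \<Rightarrow> real ^ 'N::finite"
  assumes pts: "\<forall>i. pts i \<in> {-1<..<1}"
    and P: "is_basis_of P (poly_deg n)"
    and \<alpha>: "\<alpha> \<in> poly_maps n"
    and eq: "\<forall>y \<in> {-1<..<1}. Phi_mat P pts *v \<alpha> y = psi_vec P y"
    and f: "f \<in> poly_maps n" and y: "y \<in> {-1..1}"
  shows "Pi_op pts \<alpha> f y = f y"
proof -
  \<comment> \<open>For \<open>p = P j\<close> this is row \<open>j\<close> of the system
    \<open>Phi_mat P pts *v \<alpha> z = psi_vec P z\<close>. Both sides are linear in
    \<open>p\<close>, so span induction carries it to all of the span.\<close>
  have rep: "(\<Sum>i\<in>UNIV. \<alpha> z $ i * poly p (pts i)) = poly p z"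
    if "p \<in> poly_vs.span (range P)" "z \<in> {-1<..<1}" for p z
    using that(1)
  proof (induction rule: poly_vs.span_induct_alt)
    case base
    show ?case by simp
  next
    case (step c b q)
    then obtain j where b: "b = P j" by blast
    have "(Phi_mat P pts *v \<alpha> z) $ j = psi_vec P z $ j"
      using eq that(2) by simp
    then have "(\<Sum>i\<in>UNIV. \<alpha> z $ i * poly b (pts i)) = poly b z"
      by (simp add: b Phi_mat_def psi_vec_def matrix_vector_mult_def mult.commute)
    moreover have "(\<Sum>i\<in>UNIV. \<alpha> z $ i * poly (smult c b + q) (pts i))
        = c * (\<Sum>i\<in>UNIV. \<alpha> z $ i * poly b (pts i)) + (\<Sum>i\<in>UNIV. \<alpha> z $ i * poly q (pts i))"
      by (simp add: algebra_simps sum.distrib sum_distrib_left)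
    ultimately show ?case
      using step.IH by simp
  qed
  have cont: "continuous_on {-1..1} (\<lambda>y. Pi_op pts \<alpha> f y - f y)"
    by (intro continuous_on_diff continuous_on_poly_maps[of _ n] Pi_op_in_poly_maps \<alpha> f)
  have zero: "Pi_op pts \<alpha> f z - f z = 0" if z: "z \<in> {-1<..<1}" for z
  proof -
    \<comment> \<open>\<open>Pi_op\<close> applies the same scalar coefficients to each coordinate,
      which reduces the claim to \<open>rep\<close>. The nodes lie in the interval, so there the
      coordinate of \<open>f\<close> agrees with its polynomial.\<close>
    have "Pi_op pts \<alpha> f z $ k = f z $ k" for k
    proof -
      obtain p where p: "p \<in> poly_deg n" "\<forall>y \<in> {-1..1}. f y $ k = poly p y"
        using f by (auto simp: poly_maps_def)
      have p_pts: "f (pts i) $ k = poly p (pts i)" for i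
        using p(2) pts[rule_format, of i] by auto
      have "p \<in> poly_vs.span (range P)"
        using P p(1) by (simp add: is_basis_of_def)
      from rep[OF this z] show ?thesis
        using p(2) z by (simp add: Pi_op_def p_pts)
    qed
    then show ?thesis by (simp add: vec_eq_iff)
  qed
  have "Pi_op pts \<alpha> f y - f y = 0"
    using continuous_constant_on_closure[of "{-1<..<1}" "\<lambda>y. Pi_op pts \<alpha> f y - f y" 0 y] cont zero y
    by simp
  then show ?thesis by simp
qed

text \<open>\<open>Pi_op\<close> sees \<open>f\<close> only through its nodal values, so a bound
  \<open>M\<close> at the nodes suffices. A pointwise estimate is integrated, and the total weight
  is the price of Cauchy-Schwarz.\<close>

lemma L2_norm_A_Pi_op_le:
  fixes A :: "real ^ 'm::finite ^ 'm" and \<alpha> :: "real \<Rightarrow> real ^ 'N::finite"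
    and f :: "real \<Rightarrow> real ^ 'm"
  assumes A: "sym_pos_def A"
    and w: "\<forall>i. w i > 0"
    and \<alpha>: "\<alpha> \<in> poly_maps n"
    and f: "\<And>i. norm_A A (f (pts i)) \<le> M" and M: "0 \<le> M"
  shows "L2_norm_A A (Pi_op pts \<alpha> f)
    \<le> sqrt ((\<Sum>i\<in>UNIV. w i)
        * (LBINT y:{-1..1}. (norm (matrix_inv (weight_mat w) *v \<alpha> y))\<^sup>2)) * M"
proof -
  let ?s = "\<Sum>i\<in>UNIV. w i"
  let ?g = "\<lambda>y. (norm (matrix_inv (weight_mat w) *v \<alpha> y))\<^sup>2"
  have nonneg: "0 \<le> z \<bullet> (A *v z)" for z
    using A by (cases "z = 0") (auto simp: sym_pos_def_def less_imp_le)
  have s: "0 \<le> ?s"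
    using w by (intro sum_nonneg) (auto intro: less_imp_le)
  have form: "f (pts i) \<bullet> (A *v f (pts i)) \<le> M\<^sup>2" for i
    using f[of i] unfolding norm_A_def by (rule sqrt_le_D)
  have pointwise: "(norm_A A (Pi_op pts \<alpha> f y))\<^sup>2 \<le> ?s * M\<^sup>2 * ?g y" for y
  proof -
    \<comment> \<open>Splitting off \<open>sqrt (w i)\<close> makes the two Cauchy-Schwarz factors
      the total weight and the squared norm of the rescaled coefficients.\<close>
    have "(\<Sum>i\<in>UNIV. \<bar>\<alpha> y $ i\<bar>) = (\<Sum>i\<in>UNIV. sqrt (w i) * (\<bar>\<alpha> y $ i\<bar> / sqrt (w i)))"
      using w by (intro sum.cong) (auto simp: less_imp_neq[symmetric])
    then have "(\<Sum>i\<in>UNIV. \<bar>\<alpha> y $ i\<bar>)\<^sup>2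
        \<le> (\<Sum>i\<in>UNIV. (sqrt (w i))\<^sup>2) * (\<Sum>i\<in>UNIV. (\<bar>\<alpha> y $ i\<bar> / sqrt (w i))\<^sup>2)"
      by (simp only: Cauchy_Schwarz_ineq_sum)
    also have "(\<Sum>i\<in>UNIV. (sqrt (w i))\<^sup>2) = ?s"
      using w by (simp add: less_imp_le)
    also have "(\<Sum>i\<in>UNIV. (\<bar>\<alpha> y $ i\<bar> / sqrt (w i))\<^sup>2) = ?g y"
      unfolding weight_mat_inv_mult[OF w] power2_norm_eq_inner inner_vec_def
      by (simp add: power2_eq_square)
    finally have sum_le: "(\<Sum>i\<in>UNIV. \<bar>\<alpha> y $ i\<bar>)\<^sup>2 \<le> ?s * ?g y" .
    have "(norm_A A (Pi_op pts \<alpha> f y))\<^sup>2 = Pi_op pts \<alpha> f y \<bullet> (A *v Pi_op pts \<alpha> f y)"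
      by (simp add: norm_A_def nonneg)
    also have "\<dots> \<le> M\<^sup>2 * (\<Sum>i\<in>UNIV. \<bar>\<alpha> y $ i\<bar>)\<^sup>2"
      unfolding Pi_op_def by (rule quadratic_form_sum_le[OF A form])
    also have "\<dots> \<le> M\<^sup>2 * (?s * ?g y)"
      by (intro mult_left_mono sum_le) simp
    finally show ?thesis by (simp add: mult_ac)
  qed
  have "continuous_on {-1..1} ?g"
    by (intro continuous_on_power continuous_on_norm
        linear_continuous_on_compose[OF continuous_on_poly_maps[OF \<alpha>] matrix_vector_mul_linear])
  then have "set_integrable lborel {-1..1} ?g"
    by (rule borel_integrable_atLeastAtMost')
  then have "set_integrable lborel {-1..1} (\<lambda>y. ?s * M\<^sup>2 * ?g y)"
    by (rule set_integrable_mult_right)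
  \<comment> \<open>The majorant is nonnegative, so the passage from the open to the closed interval
    only enlarges its integral; its integrability is what \<open>integral_mono'\<close> asks
    for.\<close>
  then have "(LBINT y:{-1<..<1}. (norm_A A (Pi_op pts \<alpha> f y))\<^sup>2)
      \<le> (LBINT y:{-1..1}. ?s * M\<^sup>2 * ?g y)"
    unfolding set_lebesgue_integral_def set_integrable_def
  proof (rule integral_mono')
    fix y :: real
    show nn: "0 \<le> indicator {-1..1} y *\<^sub>R (?s * M\<^sup>2 * ?g y)"
      using s by (auto simp: indicator_def)
    show "indicator {-1<..<1} y *\<^sub>R (norm_A A (Pi_op pts \<alpha> f y))\<^sup>2
        \<le> indicator {-1..1} y *\<^sub>R (?s * M\<^sup>2 * ?g y)"
      using pointwise[of y] nn by (auto simp: indicator_def)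
  qed
  also have "\<dots> = ?s * (LBINT y:{-1..1}. ?g y) * M\<^sup>2"
    by (simp add: mult_ac)
  finally have "L2_norm_A A (Pi_op pts \<alpha> f) \<le> sqrt (?s * (LBINT y:{-1..1}. ?g y) * M\<^sup>2)"
    unfolding L2_norm_A_def by (rule real_sqrt_le_mono)
  then show ?thesis
    using M by (simp add: real_sqrt_mult)
qed

theorem theorem4p1:
  fixes n :: nat
    and A\<^sub>0 :: "real ^ 'm::finite ^ 'm"
    and pts w :: "'N::finite \<Rightarrow> real"
    and P :: "'d::finite \<Rightarrow> real poly"
    and \<alpha> :: "real \<Rightarrow> real ^ 'N"
    and e :: real
  assumes "sym_pos_def A\<^sub>0"
    and "\<forall>i. pts i \<in> {-1<..<1}"
    and "\<forall>i. w i > 0"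
    and "inner_product_on (poly_deg n) (discrete_ip pts w)"
    and "(\<Sum>i\<in>UNIV. w i) = 2"
    and "e = quad_error n pts w"
    and "e < 1"
    and "CARD('d) = n + 1"
    and "is_basis_of P (poly_deg n)"
    and "\<forall>i j. i \<noteq> j \<longrightarrow> discrete_ip pts w (P i) (P j) = 0"
    and "\<forall>j. (LBINT y:{-1..1}. (poly (P j) y)\<^sup>2) = 1"
    and "\<alpha> \<in> poly_maps n"
    and "\<forall>y \<in> {-1<..<1}. Phi_mat P pts *v \<alpha> y = psi_vec P y"
    and "(LBINT y:{-1..1}. (norm (matrix_inv (weight_mat w) *v \<alpha> y))\<^sup>2)
           \<le> (real n + 1) / (1 - e)"
  shows "(\<forall>f \<in> (poly_maps n :: (real \<Rightarrow> real ^ 'm) set).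
            \<forall>y \<in> {-1..1}. Pi_op pts \<alpha> f y = f y) \<and>
         (\<forall>f :: real \<Rightarrow> real ^ 'm. continuous_on {-1..1} f \<longrightarrow>
            ereal (L2_norm_A A\<^sub>0 (Pi_op pts \<alpha> f))
              \<le> ereal (sqrt ((2 * real n + 2) / (1 - e))) * Linf_norm_A A\<^sub>0 f)"
proof (intro conjI ballI allI impI)
  fix f :: "real \<Rightarrow> real ^ 'm" and y :: real
  assume "f \<in> poly_maps n" "y \<in> {-1..1}"
  with assms(2,9,12,13) show "Pi_op pts \<alpha> f y = f y"
    by (rule Pi_op_reproduces)
next
  fix f :: "real \<Rightarrow> real ^ 'm"
  assume cont: "continuous_on {-1..1} f"
  let ?C = "sqrt ((2 * real n + 2) / (1 - e))"
  have C: "0 < ?C"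
    using assms(7) by simp
  \<comment> \<open>The nodes are interior points, where continuity makes the essential supremum
    dominate the value of \<open>f\<close>.\<close>
  have bound: "ereal (norm_A A\<^sub>0 (f (pts i))) \<le> Linf_norm_A A\<^sub>0 f" for i
    unfolding Linf_norm_A_def
    using assms(2)
    by (intro le_esssup_if_continuous_on continuous_on_ereal continuous_on_norm_A
        continuous_on_subset[OF cont]) auto
  have nonneg: "0 \<le> norm_A A\<^sub>0 z" for z
    using assms(1) by (cases "z = 0") (auto simp: norm_A_def sym_pos_def_def less_imp_le)
  show "ereal (L2_norm_A A\<^sub>0 (Pi_op pts \<alpha> f)) \<le> ereal ?C * Linf_norm_A A\<^sub>0 f"
  \<comment> \<open>The norm is an extended real. The value \<infinity> makes the right-hand side
    infinite because the constant is positive, and \<open>bound\<close> excludes the value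
    -\<infinity>.\<close>
  proof (cases "Linf_norm_A A\<^sub>0 f")
    case (real M)
    have le: "norm_A A\<^sub>0 (f (pts i)) \<le> M" for i
      using bound[of i] real by simp
    \<comment> \<open>The index type is nonempty, so there is a node at which to compare.\<close>
    then have M: "0 \<le> M"
      using nonneg order_trans by blast
    \<comment> \<open>The factor 2 is the total weight; with the bound
      \<open>(real n + 1) / (1 - e)\<close> on the integral it produces the square of the stability
      constant.\<close>
    have "L2_norm_A A\<^sub>0 (Pi_op pts \<alpha> f)
        \<le> sqrt (2 * (LBINT y:{-1..1}. (norm (matrix_inv (weight_mat w) *v \<alpha> y))\<^sup>2)) * M"
      using L2_norm_A_Pi_op_le[where f = f and pts = pts, OF assms(1,3,12) le M] assms(5) by simp
    also have "\<dots> \<le> sqrt (2 * ((real n + 1) / (1 - e))) * M"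
      using assms(14) M by (intro mult_right_mono real_sqrt_le_mono mult_left_mono) auto
    also have "\<dots> = ?C * M"
      by (simp add: distrib_left)
    finally show ?thesis
      using real by simp
  next
    case PInf
    then show ?thesis using assms(7) by simp
  next
    case MInf
    then show ?thesis using bound by simp
  qed
qed

end
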